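(* Let $n = 2000k^2\log\log k$ and let $\sigma$ be a uniformly random permutation in $\mathcal{S}_n$. Then with high probability (i.e. with probability $1-o(1)$ as $k\to\infty$), $\sigma$ is $k$-universal.
   Context: $\mathcal{S}_n$ denotes the set of permutations of $[n]=\{1,\dots,n\}$. A permutation $\sigma\in\mathcal{S}_n$ contains a pattern $\pi\in\mathcal{S}_k$ if there are indices $1\le x_1<\dots<x_k\le n$ such that for all $1\le i,j\le k$, $\sigma(x_i)<\sigma(x_j)$ if and only if $\pi(i)<\pi(j)$. A permutation $\sigma$ is $k$-universal if it contains every $\pi\in\mathcal{S}_k$. Divisibility/integrality issues (e.g. $n$ being an integer) are ignored. $\log$ denotes the natural logarithm. *)

theory Defs
  imports "HOL-Probability.Probability" "HOL-Combinatorics.Permutations"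
begin

definition perms :: "nat \<Rightarrow> (nat \<Rightarrow> nat) set" where
  "perms n = {\<sigma>. \<sigma> permutes {1..n}}"

text \<open>Containment of a pattern of length \<open>k\<close> in a permutation of length \<open>n\<close>. The lengths are
  explicit arguments because permutations are total functions, equal to the identity outside
  \<open>{1..n}\<close>. The increasing indices \<open>x\<^sub>1 < \<dots> < x\<^sub>k\<close> are the values \<open>x 1, \<dots>, x k\<close>.\<close>

definition contains_pattern :: "nat \<Rightarrow> (nat \<Rightarrow> nat) \<Rightarrow> nat \<Rightarrow> (nat \<Rightarrow> nat) \<Rightarrow> bool" where
  "contains_pattern n \<sigma> k \<pi> \<longleftrightarrow>
     (\<exists>x :: nat \<Rightarrow> nat. strict_mono_on {1..k} x \<and> x ` {1..k} \<subseteq> {1..n} \<and>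
        (\<forall>i\<in>{1..k}. \<forall>j\<in>{1..k}. \<sigma> (x i) < \<sigma> (x j) \<longleftrightarrow> \<pi> i < \<pi> j))"

definition universal :: "nat \<Rightarrow> nat \<Rightarrow> (nat \<Rightarrow> nat) \<Rightarrow> bool" where
  "universal k n \<sigma> \<longleftrightarrow> (\<forall>\<pi>\<in>perms k. contains_pattern n \<sigma> k \<pi>)"

definition random_perm :: "nat \<Rightarrow> (nat \<Rightarrow> nat) pmf" where
  "random_perm n = pmf_of_set (perms n)"

end

theory Submission imports Defs "HOL-Real_Asymp.Real_Asymp" begin

text \<open>Cut the positions into \<open>k + T\<close> columns and the values into \<open>2 * k\<close> rows. Up to a factor 2 in
  probabilities the values are independent, so a given set of \<open>s\<close> cells in distinct columns is empty
  with probability at most \<open>\<delta>\<^sup>s\<close>, where \<open>\<delta>\<close> is a large negative power of \<open>l = ln k\<close>. With high probability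
  no column contains \<open>l\<close> consecutive empty cells.

  For each shift \<open>t < T\<close>, try to embed a pattern \<open>\<pi>\<close> by putting its \<open>i\<close>-th position into column \<open>i + t\<close>
  and choosing rows greedily in the order of the values. If a shift fails, at least \<open>k / l\<close> values
  are blocked on their first try. If all \<open>T = 2 * l\<^sup>2\<close> shifts fail, then about \<open>k / l\<close> values are blocked
  for at least \<open>l\<close> shifts each, and some \<open>M\<close> (about \<open>k / l\<^sup>3\<close>) of these values have all their blocked
  cells in distinct columns. This gives \<open>M * l\<close> empty cells. The union bound runs over these cell
  sets instead of over the patterns, and they are cheap to describe: the rows reached by each
  shift at every \<open>l\<^sup>6\<close>-th value cost \<open>exp (O(k / l\<^sup>3))\<close> in total, and relative to them each of the
  \<open>M\<close> values costs a factor \<open>k\<^sup>2 = exp (2 * l)\<close> and each of its \<open>l\<close> cells only a fixed power of \<open>l\<close>.\<close>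

subsection \<open>Greedy embeddings and their failures\<close>

text \<open>\<open>E r x\<close> says that the cell in row \<open>r\<close> and column \<open>x\<close> is empty, and \<open>c v\<close> is the column
  prescribed for the value \<open>v\<close>. The row \<open>greedy E c v\<close> is the first one tried for \<open>v\<close>.\<close>

primrec greedy :: "(nat \<Rightarrow> nat \<Rightarrow> bool) \<Rightarrow> (nat \<Rightarrow> nat) \<Rightarrow> nat \<Rightarrow> nat" where
  "greedy E c 0 = 0"
| "greedy E c (Suc v) = Suc (LEAST r. greedy E c v \<le> r \<and> \<not> E r (c v))"

text \<open>The assumption rules out \<open>R\<close> consecutive empty cells in the column of
  \<open>v\<close>. Hence the \<open>LEAST\<close> in the definition ranges over a nonempty set and
  is found fewer than \<open>R\<close> rows up.\<close>

lemma greedy_Suc: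
  assumes "\<And>r. \<exists>j<R. \<not> E (r + j) (c v)"
  obtains s where "greedy E c (Suc v) = Suc s" "greedy E c v \<le> s" "\<not> E s (c v)"
    "s < greedy E c v + R" "\<not> E (greedy E c v) (c v) \<Longrightarrow> s = greedy E c v"
proof -
  let ?g = "greedy E c v" and ?P = "\<lambda>r. greedy E c v \<le> r \<and> \<not> E r (c v)"
  obtain j where j: "j < R" "?P (?g + j)" using assms[of ?g] by auto
  have 1: "?P (Least ?P)" by (rule LeastI[of ?P, OF j(2)])
  have 2: "Least ?P \<le> ?g + j" by (rule Least_le[of ?P, OF j(2)])
  have 3: "Least ?P = ?g" if "\<not> E ?g (c v)"
    by (rule Least_equality) (use that in auto)
  show thesis
  proof (rule that[of "Least ?P"])
    show "Least ?P < ?g + R" using 2 j(1) by linarith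
  qed (use 1 3 in auto)
qed

lemma greedy_add_le:
  assumes "\<And>v r. v < k \<Longrightarrow> \<exists>j<R. \<not> E (r + j) (c v)" "v + d \<le> k"
  shows "greedy E c (v + d) \<le> greedy E c v + R * d"
  using assms(2)
proof (induction d)
  case (Suc d)
  have "v + d < k" using Suc.prems by simp
  then obtain s where "greedy E c (Suc (v + d)) = Suc s" "s < greedy E c (v + d) + R"
    using greedy_Suc[of R E c "v + d"] assms(1) by metis
  with Suc show ?case by auto
qed simp

text \<open>An unblocked value advances the row by exactly one, a blocked one by at most
  \<open>R\<close>. So running past row \<open>2 * k\<close> forces at least \<open>k / R\<close>
  blocked values.\<close>

lemma greedy_le_failures:
  assumes "\<And>v r. v < k \<Longrightarrow> \<exists>j<R. \<not> E (r + j) (c v)" "v \<le> k"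
  shows "greedy E c v \<le> v + R * card {u. u < v \<and> E (greedy E c u) (c u)}"
  using assms(2)
proof (induction v)
  case (Suc v)
  let ?F = "\<lambda>v. {u. u < v \<and> E (greedy E c u) (c u)}"
  obtain s where s: "greedy E c (Suc v) = Suc s" "s < greedy E c v + R"
      "\<not> E (greedy E c v) (c v) \<Longrightarrow> s = greedy E c v"
    using greedy_Suc[of R E c v] assms(1) Suc.prems by (metis Suc_le_eq)
  show ?case
  proof (cases "E (greedy E c v) (c v)")
    case True
    then have "?F (Suc v) = insert v (?F v)" by (auto simp: less_Suc_eq)
    then have "card (?F (Suc v)) = Suc (card (?F v))" by simp
    with s Suc show ?thesis by simp
  next
    case False
    then have "?F (Suc v) = ?F v" by (auto simp: less_Suc_eq)
    with s(1) s(3)[OF False] Suc show ?thesis by simp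
  qed
qed simp

lemma greedy_strict_mono:
  assumes "\<And>v r. v < k \<Longrightarrow> \<exists>j<R. \<not> E (r + j) (c v)"
  obtains s where "strict_mono_on {..<k} s" "\<And>v. v < k \<Longrightarrow> \<not> E (s v) (c v)"
    "\<And>v. v < k \<Longrightarrow> s v < greedy E c k"
    "\<And>u v. u < v \<Longrightarrow> v \<le> k \<Longrightarrow> greedy E c u < greedy E c v"
proof -
  let ?g = "greedy E c"
  have ex: "\<exists>s. ?g (Suc v) = Suc s \<and> ?g v \<le> s \<and> \<not> E s (c v)" if "v < k" for v
    using greedy_Suc[of R E c v] assms[OF that] by metis
  \<comment> \<open>The row actually used for \<open>v\<close>: \<open>greedy\<close> moves on to
    its successor.\<close>
  define s where "s v = ?g (Suc v) - 1" for v
  have s: "?g (Suc v) = Suc (s v)" "?g v \<le> s v" "\<not> E (s v) (c v)" if "v < k" for v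
    using ex[OF that] by (auto simp: s_def simp del: greedy.simps)
  have mono: "?g u < ?g v" if "u < v" "v \<le> k" for u v
    using that
  proof (induction v)
    case (Suc v)
    then show ?case using s(1,2)[of v] by (cases "u = v") (auto simp del: greedy.simps)
  qed simp
  have gle: "?g u \<le> ?g v" if "u \<le> v" "v \<le> k" for u v
    using mono[of u v] that by (cases "u = v") auto
  show thesis
  proof (rule that)
    show "strict_mono_on {..<k} s"
    proof (rule strict_mono_onI)
      fix u v assume "u \<in> {..<k}" "v \<in> {..<k}" "u < v"
      then show "s u < s v" using s(1)[of u] s(2)[of v] gle[of "Suc u" v]
        by (auto simp del: greedy.simps)
    qed
    show "s v < ?g k" if "v < k" for v
      using s(1)[OF that] gle[of "Suc v" k] that by (auto simp del: greedy.simps)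
  qed (use s mono in auto)
qed

text \<open>Cells are pairs (column, row). A star collects cells at which a single value \<open>v\<close>, sitting in
  position \<open>q\<close> of the pattern, is blocked on its first try; the entry \<open>(t, d)\<close> encodes such a cell for
  the shift \<open>t\<close>, with its row given relative to the row \<open>h (t, v div D)\<close> at which shift \<open>t\<close> reaches
  the group of \<open>D\<close> consecutive values containing \<open>v\<close>.\<close>

definition star :: "nat \<Rightarrow> (nat \<times> nat \<Rightarrow> nat) \<Rightarrow> nat \<times> nat \<times> (nat \<times> nat) list \<Rightarrow> (nat \<times> nat) set" where
  "star D h = (\<lambda>(v, q, xs). (\<lambda>(t, d). (q + t, h (t, v div D) + d)) ` set xs)"

text \<open>The first set fixes what the probability bound needs, namely the number of cells and
  distinct columns. The image restricts to cell sets with a short code \<open>(h, ss)\<close>, which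
  bounds how many there are.\<close>

definition witnesses :: "nat \<Rightarrow> nat \<Rightarrow> nat \<Rightarrow> nat \<Rightarrow> nat \<Rightarrow> nat \<Rightarrow> (nat \<times> nat) set set" where
  "witnesses k T R D \<tau> M =
     {Z. inj_on fst Z \<and> card Z = M * \<tau> \<and> fst ` Z \<subseteq> {..<k + T}} \<inter>
     (\<lambda>(h, ss). \<Union>(star D h ` set ss)) `
       ((({..<T} \<times> {..k div D}) \<rightarrow>\<^sub>E {..R * k}) \<times>
        {ss. set ss \<subseteq> {..<k} \<times> {..<k} \<times> {xs. set xs \<subseteq> {..<T} \<times> {..R * D} \<and> length xs = \<tau>}
             \<and> length ss = M})"

lemma finite_stars: "finite ({..<k} \<times> {..<k} \<times> {xs. set xs \<subseteq> {..<T} \<times> {..R * D} \<and> length xs = \<tau>})"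
  for k T R D :: nat
  by (intro finite_cartesian_product finite_lists_length_eq) auto

text \<open>It suffices to count codes. The first factor counts the reference rows \<open>h\<close>,
  kept only for every \<open>D\<close>-th value; the second counts lists of \<open>M\<close>
  stars.\<close>

lemma card_witnesses:
  "finite (witnesses k T R D \<tau> M)"
  "card (witnesses k T R D \<tau> M) \<le>
     (R * k + 1) ^ (T * (k div D + 1)) * (k * (k * (T * (R * D + 1)) ^ \<tau>)) ^ M"
proof -
  let ?S = "{..<k} \<times> {..<k} \<times> {xs. set xs \<subseteq> {..<T} \<times> {..R * D} \<and> length xs = \<tau>}"
  let ?L = "{ss. set ss \<subseteq> ?S \<and> length ss = M}"
  let ?H = "({..<T} \<times> {..k div D}) \<rightarrow>\<^sub>E {..R * k}"
  have fin: "finite (?H \<times> ?L)"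
    by (intro finite_cartesian_product finite_PiE finite_lists_length_eq finite_stars) auto
  then show "finite (witnesses k T R D \<tau> M)"
    unfolding witnesses_def by blast
  have "card (witnesses k T R D \<tau> M) \<le> card (?H \<times> ?L)"
    unfolding witnesses_def
    by (rule order_trans[OF card_mono card_image_le]) (use fin in auto)
  also have "\<dots> = (R * k + 1) ^ (T * (k div D + 1)) * (k * (k * (T * (R * D + 1)) ^ \<tau>)) ^ M"
    by (simp add: card_cartesian_product card_PiE card_lists_length_eq[OF finite_stars]
        card_lists_length_eq)
  finally show "card (witnesses k T R D \<tau> M) \<le> \<dots>" .
qed

text \<open>Double counting of blocked pairs (value, shift). Each failing shift contributes at least
  \<open>k / R\<close> pairs, while values blocked for fewer than \<open>\<tau>\<close> shifts
  account for at most \<open>k * \<tau>\<close>, half of the total \<open>T * k / R\<close>. So at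
  least \<open>k / (2 * R)\<close> values are blocked \<open>\<tau>\<close> times, and some residue
  class of positions modulo \<open>T\<close> holds a fraction \<open>1 / T\<close> of them, which is
  enough for \<open>M\<close>.\<close>

lemma many_failures_witness:
  fixes E :: "nat \<Rightarrow> nat \<Rightarrow> bool"
  assumes norun: "\<And>r x. x < k + T \<Longrightarrow> \<exists>j<R. \<not> E (r + j) x"
    and p: "inj_on p {..<k}" "p ` {..<k} \<subseteq> {..<k}"
    and pos: "k > 0" "R > 0" "\<tau> > 0" "D > 0" and T: "T = 2 * R * \<tau>"
    and M: "M * (2 * R * T) < k + 2 * R * T"
    and fail: "\<And>t. t < T \<Longrightarrow> 2 * k < greedy E (\<lambda>v. p v + t) k"
  shows "\<exists>Z\<in>witnesses k T R D \<tau> M. \<forall>(x, r)\<in>Z. E r x"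
proof -
  define g where "g t = greedy E (\<lambda>v. p v + t)" for t
  have col: "p v + t < k + T" if "v < k" "t < T" for v t
    using p(2) that by (auto intro!: add_strict_mono)
  have nr: "\<exists>j<R. \<not> E (r + j) (p v + t)" if "v < k" "t < T" for v t r
    using norun[OF col[OF that]] .
  define U where "U v = {t. t < T \<and> E (g t v) (p v + t)}" for v
  define G where "G = {v. v < k \<and> \<tau> \<le> card (U v)}"
  have Tpos: "T > 0" using pos T by simp
  have finU: "finite (U v)" for v by (auto simp: U_def)
  have cU: "card (U v) \<le> T" for v
    using card_mono[of "{..<T}" "U v"] by (auto simp: U_def)
  have fails: "k \<le> R * card {v. v < k \<and> E (g t v) (p v + t)}" if "t < T" for t
    using greedy_le_failures[of k R E "\<lambda>v. p v + t" k] nr that fail[OF that]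
    unfolding g_def by fastforce
  have "T * k \<le> (\<Sum>t<T. R * card {v. v < k \<and> E (g t v) (p v + t)})"
    using sum_mono[of "{..<T}" "\<lambda>_. k", OF fails] by simp
  also have "\<dots> = R * (\<Sum>t<T. card {v\<in>{..<k}. E (g t v) (p v + t)})"
    by (simp add: sum_distrib_left)
  also have "(\<Sum>t<T. card {v\<in>{..<k}. E (g t v) (p v + t)}) =
      (\<Sum>v<k. card {t\<in>{..<T}. E (g t v) (p v + t)})"
    unfolding card_eq_sum sum.inter_filter[OF finite_lessThan] by (rule sum.swap)
  also have "\<dots> = (\<Sum>v<k. card (U v))" by (simp add: U_def)
  also have "\<dots> \<le> (\<Sum>v<k. \<tau> + (if v \<in> G then T else 0))"
    using cU by (intro sum_mono) (auto simp: G_def intro: order_trans[OF cU])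
  also have "\<dots> = k * \<tau> + card G * T"
  proof -
    have "{..<k} \<inter> G = G" by (auto simp: G_def)
    then show ?thesis by (simp add: sum.distrib sum.If_cases)
  qed
  finally have "T * k \<le> R * (k * \<tau> + card G * T)" using pos by simp
  \<comment> \<open>As \<open>2 * R * \<tau> = T\<close>, the rarely blocked values absorb only one
    of the two copies of \<open>T * k\<close>.\<close>
  then have "2 * (T * k) \<le> 2 * R * \<tau> * k + T * (2 * R * card G)" by (simp add: algebra_simps)
  then have "T * k \<le> T * (2 * R * card G)" using T by simp
  then have cG: "k \<le> 2 * R * card G" using Tpos by simp
  obtain y where y: "card G \<le> T * card {v\<in>G. p v mod T = y}"
  proof (rule ccontr)
    assume "\<not> thesis"
    then have less: "T * card {v\<in>G. p v mod T = y} < card G" for y using that by (meson not_le)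
    have "T * card G = (\<Sum>y<T. T * card {v\<in>G. p v mod T = y})"
    proof -
      have "finite G" "(\<lambda>v. p v mod T) ` G \<subseteq> {..<T}" using Tpos by (auto simp: G_def)
      then have "card G = (\<Sum>y<T. card {v\<in>G. p v mod T = y})"
        using sum.group[of G "{..<T}" "\<lambda>v. p v mod T" "\<lambda>_. 1::nat"] by simp
      then show ?thesis by (simp add: sum_distrib_left)
    qed
    also have "\<dots> < (\<Sum>y<T. card G)"
      using Tpos less by (intro sum_strict_mono) auto
    finally show False by simp
  qed
  \<comment> \<open>Positions in one residue class modulo \<open>T\<close> keep different stars in different columns.\<close>
  define J where "J = {v\<in>G. p v mod T = y}"
  have "k \<le> 2 * R * T * card J"
    using order_trans[OF cG, of "2 * R * (T * card J)"] y unfolding J_def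
    by (simp add: mult.assoc)
  then have "M * (2 * R * T) < (card J + 1) * (2 * R * T)" using M by (simp add: algebra_simps)
  then have "M < card J + 1" by (rule mult_less_cancel2[THEN iffD1, THEN conjunct2])
  then have "M \<le> card J" by simp
  then obtain I where I: "I \<subseteq> J" "card I = M" "finite I"
    by (meson obtain_subset_with_card_n)
  have Ik: "v < k" if "v \<in> I" for v using that I(1) by (auto simp: J_def G_def)
  have "\<exists>W. W \<subseteq> U v \<and> card W = \<tau>" if "v \<in> I" for v
  proof -
    have "\<tau> \<le> card (U v)" using that I(1) by (auto simp: J_def G_def)
    then show ?thesis by (meson obtain_subset_with_card_n)
  qed
  then obtain W where W: "\<And>v. v \<in> I \<Longrightarrow> W v \<subseteq> U v" "\<And>v. v \<in> I \<Longrightarrow> card (W v) = \<tau>" by metis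
  have WT: "t < T" "E (g t v) (p v + t)" if "v \<in> I" "t \<in> W v" for v t
    using W(1)[OF that(1)] that(2) by (auto simp: U_def)
  have finW: "finite (W v)" if "v \<in> I" for v
    using W(1)[OF that] finU finite_subset by blast
  \<comment> \<open>Reference rows, one per shift and group of \<open>D\<close> values. The
    restriction puts \<open>h\<close> into the finite function space of the code.\<close>
  define h where "h = restrict (\<lambda>(t, a). g t (a * D)) ({..<T} \<times> {..k div D})"
  have h: "h \<in> ({..<T} \<times> {..k div D}) \<rightarrow>\<^sub>E {..R * k}"
  proof -
    have "g t (a * D) \<le> R * k" if "t < T" "a \<le> k div D" for t a
    proof -
      have ak: "a * D \<le> k" using that(2)
        by (metis div_times_less_eq_dividend le_trans mult_le_mono1)
      then have "g t (0 + a * D) \<le> g t 0 + R * (a * D)"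
        unfolding g_def by (intro greedy_add_le[of k]) (use nr that in auto)
      moreover have "R * (a * D) \<le> R * k" using ak by (rule mult_le_mono2)
      moreover have "g t 0 = 0" by (simp add: g_def)
      ultimately show ?thesis by (metis add_0 le_trans)
    qed
    then show ?thesis unfolding h_def by auto
  qed
  have off: "\<exists>d\<le>R * D. g t v = h (t, v div D) + d" if "v < k" "t < T" for t v
  proof -
    let ?a = "v div D"
    have v: "?a * D + v mod D = v" by simp
    have hv: "h (t, ?a) = g t (?a * D)" using that by (simp add: h_def div_le_mono)
    have "g t (?a * D + v mod D) \<le> g t (?a * D) + R * (v mod D)"
      unfolding g_def using that nr by (intro greedy_add_le[of k]) auto
    moreover have "R * (v mod D) \<le> R * D" using pos by (simp add: less_imp_le)
    moreover have "g t (?a * D) \<le> g t v"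
    proof (cases "?a * D = v")
      case False
      then have "?a * D < v" using v by (metis div_times_less_eq_dividend le_neq_implies_less)
      then show ?thesis
        using greedy_strict_mono[of k R E "\<lambda>v. p v + t"] nr that unfolding g_def
        by (metis less_imp_le)
    qed simp
    ultimately have "g t v - g t (?a * D) \<le> R * D" "g t (?a * D) \<le> g t v"
      unfolding v by linarith+
    then show ?thesis using hv by (intro exI[of _ "g t v - g t (?a * D)"]) simp
  qed
  \<comment> \<open>By \<open>off\<close> this subtraction is not truncated for the relevant
    \<open>t\<close> and \<open>v\<close>.\<close>
  define \<delta> where "\<delta> t v = g t v - h (t, v div D)" for t v
  have \<delta>: "\<delta> t v \<le> R * D" "h (t, v div D) + \<delta> t v = g t v" if "v < k" "t < T" for t v
    using off[OF that] by (auto simp: \<delta>_def)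
  have "\<exists>xs. set xs = (\<lambda>t. (t, \<delta> t v)) ` W v \<and> length xs = \<tau>" if "v \<in> I" for v
  proof -
    have "card ((\<lambda>t. (t, \<delta> t v)) ` W v) = \<tau>"
      using W(2)[OF that] by (simp add: card_image inj_on_def)
    then show ?thesis using finite_distinct_list[of "(\<lambda>t. (t, \<delta> t v)) ` W v"] finW[OF that]
      by (metis distinct_card finite_imageI)
  qed
  then have "\<forall>v\<in>I. \<exists>xs. set xs = (\<lambda>t. (t, \<delta> t v)) ` W v \<and> length xs = \<tau>" by blast
  from bchoice[OF this] obtain xs where
    xs: "\<And>v. v \<in> I \<Longrightarrow> set (xs v) = (\<lambda>t. (t, \<delta> t v)) ` W v"
      "\<And>v. v \<in> I \<Longrightarrow> length (xs v) = \<tau>" by blast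
  obtain ss where ss: "set ss = (\<lambda>v. (v, p v, xs v)) ` I" "length ss = M"
  proof -
    have "card ((\<lambda>v. (v, p v, xs v)) ` I) = M" using I(2) by (simp add: card_image inj_on_def)
    moreover obtain ss where "set ss = (\<lambda>v. (v, p v, xs v)) ` I" "distinct ss"
      using finite_distinct_list[OF finite_imageI[OF I(3), of "\<lambda>v. (v, p v, xs v)"]] by auto
    ultimately show ?thesis using that[of ss] by (simp add: distinct_card[symmetric])
  qed
  define Z where "Z = (\<lambda>(v, t). (p v + t, g t v)) ` (SIGMA v:I. W v)"
  have "star D h (v, p v, xs v) = (\<lambda>t. (p v + t, g t v)) ` W v" if "v \<in> I" for v
    unfolding star_def using \<delta>(2)[OF Ik[OF that] WT(1)[OF that]]
    by (simp add: xs(1)[OF that] image_image cong: image_cong)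
  then have ZU: "Z = \<Union>(star D h ` set ss)"
    unfolding ss(1) Z_def by (auto simp: image_image)
  have inj: "v = v' \<and> t = t'"
    if "v \<in> I" "v' \<in> I" "t \<in> W v" "t' \<in> W v'" "p v + t = p v' + t'" for v v' t t'
  proof -
    have "p v mod T = p v' mod T" using that(1,2) I(1) by (auto simp: J_def)
    \<comment> \<open>The equal residues cancel; reducing modulo \<open>T\<close> then leaves the
      shifts, both below \<open>T\<close>.\<close>
    then have "T * (p v div T) + t = T * (p v' div T) + t'"
      using that(5) mult_div_mod_eq[of T "p v"] mult_div_mod_eq[of T "p v'"] by linarith
    then have "(T * (p v div T) + t) mod T = (T * (p v' div T) + t') mod T" by simp
    then have "t = t'" using WT(1) that by simp
    then have "p v = p v'" using that(5) by simp
    then show ?thesis using p(1) Ik that(1,2) \<open>t = t'\<close> by (auto simp: inj_on_def)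
  qed
  have injZ: "inj_on fst Z"
  proof (rule inj_onI)
    fix z z' assume "z \<in> Z" "z' \<in> Z" "fst z = fst z'"
    then obtain v t v' t' where vt: "v \<in> I" "t \<in> W v" "z = (p v + t, g t v)"
      "v' \<in> I" "t' \<in> W v'" "z' = (p v' + t', g t' v')" unfolding Z_def by auto
    with inj[of v v' t t'] \<open>fst z = fst z'\<close> show "z = z'" by simp
  qed
  have "card Z = card (SIGMA v:I. W v)"
    unfolding Z_def
  proof (rule card_image, rule inj_onI, clarify)
    fix v t v' t' assume "v \<in> I" "t \<in> W v" "v' \<in> I" "t' \<in> W v'" "p v + t = p v' + t'"
    with inj show "v = v' \<and> t = t'" by blast
  qed
  also have "\<dots> = M * \<tau>" using I finW W(2) by simp
  finally have cZ: "card Z = M * \<tau>" .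
  have colZ: "fst ` Z \<subseteq> {..<k + T}"
    using col[OF Ik WT(1)] by (auto simp: Z_def)
  have "set ss \<subseteq> {..<k} \<times> {..<k} \<times> {xs. set xs \<subseteq> {..<T} \<times> {..R * D} \<and> length xs = \<tau>}"
    unfolding ss(1)
  proof (intro image_subsetI SigmaI CollectI conjI)
    fix v assume v: "v \<in> I"
    show "v \<in> {..<k}" "p v \<in> {..<k}" using Ik[OF v] p(2) by auto
    show "set (xs v) \<subseteq> {..<T} \<times> {..R * D}"
      using WT(1)[OF v] \<delta>(1)[OF Ik[OF v]] by (auto simp: xs(1)[OF v])
    show "length (xs v) = \<tau>" using xs(2)[OF v] .
  qed
  then have "Z \<in> witnesses k T R D \<tau> M"
    unfolding witnesses_def using injZ cZ colZ h ss(2) ZU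
    by (intro IntI CollectI conjI image_eqI[of _ _ "(h, ss)"] SigmaI) simp_all
  moreover have "\<forall>(x, r)\<in>Z. E r x" using WT(2) by (auto simp: Z_def)
  ultimately show ?thesis by blast
qed

subsection \<open>Independent values instead of a random permutation\<close>

text \<open>A permutation of \<open>{1..n}\<close> together with an \<open>n\<close>-element set of values is the same as an injective
  function; this is how a uniformly random permutation is traded for independent values.\<close>

definition relabel :: "nat \<Rightarrow> (nat \<Rightarrow> nat) \<Rightarrow> nat set \<Rightarrow> nat \<Rightarrow> nat" where
  "relabel n \<sigma> S = (\<lambda>q\<in>{1..n}. sorted_list_of_set S ! (\<sigma> q - 1))"

lemma perms_bij: "\<sigma> \<in> perms n \<Longrightarrow> bij_betw \<sigma> {1..n} {1..n}"
  by (simp add: perms_def permutes_imp_bij)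

text \<open>Pattern containment depends only on the order of the values, and the sorted enumeration
  of \<open>S\<close> preserves it. List indices start at 0, hence
  \<open>\<sigma> q - 1\<close>.\<close>

lemma relabel_less_iff:
  assumes "\<sigma> \<in> perms n" "finite S" "card S = n" "q \<in> {1..n}" "q' \<in> {1..n}"
  shows "relabel n \<sigma> S q < relabel n \<sigma> S q' \<longleftrightarrow> \<sigma> q < \<sigma> q'"
proof -
  let ?l = "sorted_list_of_set S"
  have len: "length ?l = n" using assms by simp
  have mono: "?l ! i < ?l ! j" if "i < j" "j < n" for i j
    using sorted_wrt_nth_less[OF strict_sorted_list_of_set, of i j S] that assms by simp
  have r: "\<sigma> q \<in> {1..n}" "\<sigma> q' \<in> {1..n}"
    using perms_bij[OF assms(1)] assms(4,5) by (auto dest: bij_betwE)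
  have lt: "?l ! (i - 1) < ?l ! (j - 1)" if "i < j" "i \<in> {1..n}" "j \<in> {1..n}" for i j
    by (rule mono) (use that in auto)
  have "?l ! (\<sigma> q - 1) < ?l ! (\<sigma> q' - 1) \<longleftrightarrow> \<sigma> q < \<sigma> q'"
    using lt[OF _ r] lt[OF _ r(2,1)] by (metis less_asym nat_neq_iff)
  then show ?thesis using assms(4,5) by (simp add: relabel_def)
qed

lemma relabel_image:
  assumes "\<sigma> \<in> perms n" "finite S" "card S = n"
  shows "relabel n \<sigma> S ` {1..n} = S"
proof -
  have "relabel n \<sigma> S ` {1..n} = (\<lambda>i. sorted_list_of_set S ! (i - 1)) ` (\<sigma> ` {1..n})"
    by (simp add: relabel_def image_image)
  also have "\<sigma> ` {1..n} = Suc ` {..<n}"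
    using perms_bij[OF assms(1)] by (simp add: bij_betw_def image_Suc_lessThan)
  also have "(\<lambda>i. sorted_list_of_set S ! (i - 1)) ` (Suc ` {..<n}) = set (sorted_list_of_set S)"
    using assms by (auto simp: image_image set_conv_nth)
  finally show ?thesis using assms by simp
qed

text \<open>The image of the function gives back \<open>S\<close>; then the index of each value in
  the sorted list gives back the permutation.\<close>

lemma relabel_inj:
  "inj_on (\<lambda>(\<sigma>, S). relabel n \<sigma> S) (perms n \<times> {S. S \<subseteq> {..<N} \<and> card S = n})"
proof (rule inj_onI)
  fix u u'
  assume u: "u \<in> perms n \<times> {S. S \<subseteq> {..<N} \<and> card S = n}" "u' \<in> perms n \<times> {S. S \<subseteq> {..<N} \<and> card S = n}"
    and equ: "(\<lambda>(\<sigma>, S). relabel n \<sigma> S) u = (\<lambda>(\<sigma>, S). relabel n \<sigma> S) u'"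
  obtain \<sigma> S \<sigma>' S' where uu: "u = (\<sigma>, S)" "u' = (\<sigma>', S')" by (cases u, cases u') blast
  have \<sigma>: "\<sigma> \<in> perms n" "\<sigma>' \<in> perms n" using u uu by auto
  have S: "finite S" "finite S'" "card S = n" "card S' = n"
    using u uu finite_subset[OF _ finite_lessThan[of N]] by auto
  have eq: "relabel n \<sigma> S = relabel n \<sigma>' S'" using equ uu by simp
  have SS: "S = S'"
    using relabel_image[OF \<sigma>(1) S(1,3)] relabel_image[OF \<sigma>(2) S(2,4)] unfolding eq by simp
  have "\<sigma> q = \<sigma>' q" for q
  proof (cases "q \<in> {1..n}")
    case True
    have r: "\<sigma> q \<in> {1..n}" "\<sigma>' q \<in> {1..n}"
      using bij_betwE[OF perms_bij[OF \<sigma>(1)]] bij_betwE[OF perms_bij[OF \<sigma>(2)]] True by blast+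
    have "sorted_list_of_set S ! (\<sigma> q - 1) = sorted_list_of_set S ! (\<sigma>' q - 1)"
      using fun_cong[OF eq, of q] True unfolding relabel_def SS[symmetric] by simp
    moreover have "\<sigma> q - 1 < length (sorted_list_of_set S)" "\<sigma>' q - 1 < length (sorted_list_of_set S)"
      using r S(3) by auto
    ultimately have "\<sigma> q - 1 = \<sigma>' q - 1"
      using nth_eq_iff_index_eq[OF distinct_sorted_list_of_set] by blast
    then show ?thesis using r by auto
  next
    case False
    then show ?thesis using \<sigma> unfolding perms_def permutes_def by simp
  qed
  then have "\<sigma> = \<sigma>'" by (rule ext)
  then show "u = u'" using SS uu by simp
qed

text \<open>A birthday bound: at least half of all functions are injective. The falling factorial is
  at least \<open>(N - n) ^ n\<close>, and Bernoulli's inequality gives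
  \<open>(1 - n / N) ^ n \<ge> 1 - n * n / N \<ge> 1 / 2\<close>.\<close>

lemma fact_mult_binomial_ge:
  assumes "2 * n\<^sup>2 \<le> N" "0 < N"
  shows "real N ^ n \<le> 2 * (fact n * real (N choose n))"
proof -
  have nN: "real n * real n * 2 \<le> real N"
    using assms(1) by (metis of_nat_le_iff of_nat_mult of_nat_numeral power2_eq_square mult.commute)
  have "n \<le> N" using assms(1) by (cases n) (auto simp: power2_eq_square)
  have "1 / 2 \<le> 1 + real n * (- (real n / real N))"
    using nN assms(2) by (simp add: field_simps)
  also have "\<dots> \<le> (1 + - (real n / real N)) ^ n"
    by (rule Bernoulli_inequality) (use \<open>n \<le> N\<close> assms(2) in simp)
  finally have "real N ^ n * (1 / 2) \<le> real N ^ n * (1 + - (real n / real N)) ^ n"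
    by (intro mult_left_mono) auto
  also have "\<dots> = (real N - real n) ^ n"
    using assms(2) by (simp flip: power_mult_distrib add: field_simps)
  also have "\<dots> = (\<Prod>i=0..<n. real N - real n)" by simp
  also have "\<dots> \<le> (\<Prod>i=0..<n. real N - real i)"
    using \<open>n \<le> N\<close> by (intro prod_mono) auto
  also have "\<dots> = fact n * real (N choose n)"
    using gbinomial_mult_fact[of n "real N"] by (simp add: binomial_gbinomial)
  finally show ?thesis by simp
qed

text \<open>Relabelling injects the pairs of a bad permutation and an \<open>n\<close>-element value
  set into \<open>F\<close>. The birthday bound then replaces the number of injective functions by
  \<open>N ^ n\<close> at the cost of a factor 2.\<close>

lemma prob_random_perm_le:
  assumes "2 * n\<^sup>2 \<le> N" "0 < N" and F: "finite F"
    and sub: "\<And>\<sigma> S. \<sigma> \<in> perms n \<Longrightarrow> \<sigma> \<in> A \<Longrightarrow> S \<subseteq> {..<N} \<Longrightarrow> card S = n \<Longrightarrow> relabel n \<sigma> S \<in> F"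
  shows "measure_pmf.prob (random_perm n) A \<le> 2 * (real (card F) / real N ^ n)"
proof -
  have fin: "finite (perms n)" by (simp add: perms_def finite_permutations)
  have c: "card (perms n) = fact n" by (simp add: perms_def card_permutations)
  have ne: "perms n \<noteq> {}" using c fact_nonzero by (metis card.empty)
  let ?B = "perms n \<inter> A" and ?Ss = "{S. S \<subseteq> {..<N} \<and> card S = n}"
  have "card ?B * (N choose n) = card (?B \<times> ?Ss)"
    using n_subsets[of "{..<N}" n] by (simp add: card_cartesian_product)
  also have "\<dots> \<le> card F"
  proof (rule card_inj_on_le[OF _ _ F])
    show "inj_on (\<lambda>(\<sigma>, S). relabel n \<sigma> S) (?B \<times> ?Ss)"
      by (rule inj_on_subset[OF relabel_inj[of n N]]) auto
  qed (use sub in auto)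
  finally have le: "real (card ?B) * real (N choose n) \<le> real (card F)"
    by (metis of_nat_le_iff of_nat_mult)
  have "measure_pmf.prob (random_perm n) A = real (card ?B) / fact n"
    using ne fin c by (simp add: random_perm_def measure_pmf_of_set)
  also have "\<dots> \<le> 2 * (real (card F) / real N ^ n)"
  proof -
    have "real (card ?B) * real N ^ n \<le> real (card ?B) * (2 * (fact n * real (N choose n)))"
      by (intro mult_left_mono fact_mult_binomial_ge assms) auto
    also have "\<dots> = 2 * fact n * (real (card ?B) * real (N choose n))" by simp
    also have "\<dots> \<le> 2 * fact n * real (card F)"
      by (intro mult_left_mono le) auto
    finally show ?thesis using assms(2) by (simp add: field_simps)
  qed
  finally show ?thesis .
qed

section \<open>Counting functions with prescribed empty cells\<close>

text \<open>Independence of the values in counting form: the set is a product in which each position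
  of \<open>P\<close> loses \<open>\<beta>\<close> of its \<open>N\<close> values.\<close>

lemma card_avoiding_functions:
  assumes "P \<subseteq> {1..n}" "\<And>q. q \<in> P \<Longrightarrow> B q \<subseteq> {..<N} \<and> card (B q) = \<beta>" "0 < N" "\<beta> \<le> N"
  shows "real (card {f \<in> {1..n} \<rightarrow>\<^sub>E {..<N}. \<forall>q\<in>P. f q \<notin> B q}) =
         real N ^ n * (1 - real \<beta> / real N) ^ card P"
proof -
  have "{f \<in> {1..n} \<rightarrow>\<^sub>E {..<N}. \<forall>q\<in>P. f q \<notin> B q} =
      (\<Pi>\<^sub>E q\<in>{1..n}. if q \<in> P then {..<N} - B q else {..<N})"
  proof (intro set_eqI iffI)
    fix f assume "f \<in> {f \<in> {1..n} \<rightarrow>\<^sub>E {..<N}. \<forall>q\<in>P. f q \<notin> B q}"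
    then show "f \<in> (\<Pi>\<^sub>E q\<in>{1..n}. if q \<in> P then {..<N} - B q else {..<N})"
      by (auto simp: PiE_iff)
  next
    fix f assume f: "f \<in> (\<Pi>\<^sub>E q\<in>{1..n}. if q \<in> P then {..<N} - B q else {..<N})"
    have "f \<in> {1..n} \<rightarrow>\<^sub>E {..<N}"
      by (rule subsetD[OF PiE_mono f]) auto
    moreover have "f q \<notin> B q" if "q \<in> P" for q
    proof -
      have "q \<in> {1..n}" using that assms(1) by blast
      from PiE_mem[OF f this] show ?thesis using that by simp
    qed
    ultimately show "f \<in> {f \<in> {1..n} \<rightarrow>\<^sub>E {..<N}. \<forall>q\<in>P. f q \<notin> B q}" by blast
  qed
  then have "card {f \<in> {1..n} \<rightarrow>\<^sub>E {..<N}. \<forall>q\<in>P. f q \<notin> B q} =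
      (\<Prod>q\<in>{1..n}. card (if q \<in> P then {..<N} - B q else {..<N}))"
    by (simp add: card_PiE)
  also have "\<dots> = (\<Prod>q\<in>{1..n}. if q \<in> P then N - \<beta> else N)"
  proof (rule prod.cong[OF refl])
    fix q
    have "card ({..<N} - B q) = N - \<beta>" if "q \<in> P"
      using assms(2)[OF that] finite_subset[of "B q" "{..<N}"] by (simp add: card_Diff_subset)
    then show "card (if q \<in> P then {..<N} - B q else {..<N}) = (if q \<in> P then N - \<beta> else N)"
      by simp
  qed
  finally have "real (card {f \<in> {1..n} \<rightarrow>\<^sub>E {..<N}. \<forall>q\<in>P. f q \<notin> B q}) =
      (\<Prod>q\<in>{1..n}. real N * (if q \<in> P then 1 - real \<beta> / real N else 1))"
    using assms(3,4) by (auto simp: of_nat_prod field_simps of_nat_diff intro!: prod.cong)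
  also have "\<dots> = real N ^ n * (\<Prod>q\<in>{1..n}. if q \<in> P then 1 - real \<beta> / real N else 1)"
    by (simp add: prod.distrib)
  also have "(\<Prod>q\<in>{1..n}. if q \<in> P then 1 - real \<beta> / real N else 1) =
      (1 - real \<beta> / real N) ^ card P"
    using assms(1) by (simp add: prod.If_cases Int_absorb1)
  finally show ?thesis .
qed

text \<open>The positions in column \<open>x\<close>; columns are numbered from 0, positions from
  1.\<close>

definition blk :: "nat \<Rightarrow> nat \<Rightarrow> nat set" where
  "blk b x = {x * b + 1..x * b + b}"

text \<open>There are only \<open>2 * k\<close> rows; the cells above them count as nonempty, so that the greedy procedure
  always continues and failure means running past row \<open>2 * k\<close>.\<close>

definition empty_cell :: "nat \<Rightarrow> nat \<Rightarrow> nat \<Rightarrow> (nat \<Rightarrow> nat) \<Rightarrow> nat \<Rightarrow> nat \<Rightarrow> bool" where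
  "empty_cell k b w f r x \<longleftrightarrow> r < 2 * k \<and> (\<forall>q\<in>blk b x. f q div w \<noteq> r)"

lemma card_blk: "card (blk b x) = b"
  by (simp add: blk_def)

lemma finite_blk: "finite (blk b x)"
  by (simp add: blk_def)

lemma blk_less:
  assumes "x < y" "q \<in> blk b x" "q' \<in> blk b y"
  shows "q < q'"
proof -
  have "Suc x * b \<le> y * b" using assms(1) by (intro mult_le_mono1) simp
  then show ?thesis using assms(2,3) by (auto simp: blk_def)
qed

lemma blk_disjoint: "x \<noteq> y \<Longrightarrow> blk b x \<inter> blk b y = {}"
  using blk_less[of x y] blk_less[of y x] by (metis disjoint_iff less_irrefl nat_neq_iff)

lemma blk_subset:
  assumes "x < m" "b * m \<le> n"
  shows "blk b x \<subseteq> {1..n}"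
proof -
  have "Suc x * b \<le> m * b" using assms(1) by (intro mult_le_mono1) simp
  then show ?thesis using assms(2) by (auto simp: blk_def mult.commute)
qed

lemma div_eq_interval:
  assumes "0 < w"
  shows "{y::nat. y div w = r} = {r * w..<Suc r * w}"
  using assms by (auto simp: div_nat_eqI less_mult_imp_div_less div_less_iff_less_mult mult.commute)
    (metis dividend_less_times_div mult.commute add.commute)+

text \<open>The \<open>R\<close> cells merge into one interval of \<open>R * w\<close> values, which
  each of the \<open>b\<close> positions of the column has to avoid.\<close>

lemma card_empty_run:
  assumes "x < m" "b * m \<le> n" "0 < w" "0 < k" "r + R \<le> 2 * k"
  shows "real (card {f \<in> {1..n} \<rightarrow>\<^sub>E {..<2 * k * w}. \<forall>j<R. empty_cell k b w f (r + j) x}) =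
         real (2 * k * w) ^ n * (1 - real R / real (2 * k)) ^ b"
proof -
  let ?N = "2 * k * w" and ?B = "{r * w..<(r + R) * w}"
  have B: "y \<in> ?B \<longleftrightarrow> r \<le> y div w \<and> y div w < r + R" for y
    using assms(3) by (simp add: less_eq_div_iff_mult_less_eq div_less_iff_less_mult)
  have "(\<forall>j<R. empty_cell k b w f (r + j) x) \<longleftrightarrow> (\<forall>q\<in>blk b x. f q \<notin> ?B)" for f
  proof
    assume *: "\<forall>j<R. empty_cell k b w f (r + j) x"
    show "\<forall>q\<in>blk b x. f q \<notin> ?B"
    proof
      fix q assume "q \<in> blk b x"
      then show "f q \<notin> ?B" using *[rule_format, of "f q div w - r"] unfolding B
        by (fastforce simp: empty_cell_def)
    qed
  next
    assume "\<forall>q\<in>blk b x. f q \<notin> ?B"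
    then show "\<forall>j<R. empty_cell k b w f (r + j) x"
      unfolding B using assms(5) by (auto simp: empty_cell_def)
  qed
  then have "real (card {f \<in> {1..n} \<rightarrow>\<^sub>E {..<?N}. \<forall>j<R. empty_cell k b w f (r + j) x}) =
      real (card {f \<in> {1..n} \<rightarrow>\<^sub>E {..<?N}. \<forall>q\<in>blk b x. f q \<notin> ?B})" by simp
  also have "\<dots> = real ?N ^ n * (1 - real (R * w) / real ?N) ^ card (blk b x)"
  proof (rule card_avoiding_functions)
    show "blk b x \<subseteq> {1..n}" using blk_subset[OF assms(1,2)] .
    have "(r + R) * w \<le> ?N" using assms(5) by (rule mult_le_mono1)
    then show "?B \<subseteq> {..<?N} \<and> card ?B = R * w" for q :: nat by (auto simp: algebra_simps)
    show "R * w \<le> ?N" using assms(5) by simp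
  qed (use assms in auto)
  also have "real (R * w) / real ?N = real R / real (2 * k)" using assms(3) by simp
  finally show ?thesis by (simp add: card_blk)
qed

text \<open>Distinct columns are disjoint blocks of positions, so \<open>b * card Z\<close>
  positions each have to avoid the \<open>w\<close> values of one row. A cell in row
  \<open>2 * k\<close> or above is never empty, which makes the other case trivial.\<close>

lemma card_empty_cells:
  assumes "fst ` Z \<subseteq> {..<m}" "inj_on fst Z" "b * m \<le> n" "0 < w" "0 < k"
  shows "real (card {f \<in> {1..n} \<rightarrow>\<^sub>E {..<2 * k * w}. \<forall>(x, r)\<in>Z. empty_cell k b w f r x}) \<le>
         real (2 * k * w) ^ n * (1 - 1 / real (2 * k)) ^ (b * card Z)"
proof (cases "\<forall>(x, r)\<in>Z. r < 2 * k")
  case True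
  let ?N = "2 * k * w"
  \<comment> \<open>\<open>row\<close> and \<open>cl\<close> recover the row from the column and the
    column from the position; uniqueness comes from injectivity of \<open>fst\<close> and
    disjointness of the blocks.\<close>
  define row where "row x = (THE r. (x, r) \<in> Z)" for x
  have row: "row x = r" if "(x, r) \<in> Z" for x r
    unfolding row_def
  proof (rule the_equality)
    fix r' assume "(x, r') \<in> Z"
    then show "r' = r" using inj_onD[OF assms(2), of "(x, r')" "(x, r)"] that by simp
  qed (rule that)
  define cl where "cl q = (THE x. x \<in> fst ` Z \<and> q \<in> blk b x)" for q
  have cl: "cl q = x" if "(x, r) \<in> Z" "q \<in> blk b x" for q x r
    unfolding cl_def using that blk_disjoint[of _ x b]
    by (intro the_equality) (force, blast)
  let ?P = "\<Union>x\<in>fst ` Z. blk b x"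
  let ?B = "\<lambda>q. {y. y div w = row (cl q)}"
  have finZ: "finite (fst ` Z)" using assms(1) finite_subset by blast
  have "{f \<in> {1..n} \<rightarrow>\<^sub>E {..<?N}. \<forall>(x, r)\<in>Z. empty_cell k b w f r x} \<subseteq>
      {f \<in> {1..n} \<rightarrow>\<^sub>E {..<?N}. \<forall>q\<in>?P. f q \<notin> ?B q}"
    using row cl by (fastforce simp: empty_cell_def)
  then have "card {f \<in> {1..n} \<rightarrow>\<^sub>E {..<?N}. \<forall>(x, r)\<in>Z. empty_cell k b w f r x} \<le>
      card {f \<in> {1..n} \<rightarrow>\<^sub>E {..<?N}. \<forall>q\<in>?P. f q \<notin> ?B q}"
    by (intro card_mono finite_subset[OF _ finite_PiE[of "{1..n}" "\<lambda>_. {..<?N}"]]) auto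
  then have "real (card {f \<in> {1..n} \<rightarrow>\<^sub>E {..<?N}. \<forall>(x, r)\<in>Z. empty_cell k b w f r x}) \<le>
      real (card {f \<in> {1..n} \<rightarrow>\<^sub>E {..<?N}. \<forall>q\<in>?P. f q \<notin> ?B q})" by simp
  also have "\<dots> = real ?N ^ n * (1 - real w / real ?N) ^ card ?P"
  proof (rule card_avoiding_functions)
    show "?P \<subseteq> {1..n}" using blk_subset[OF _ assms(3)] assms(1) by blast
    fix q assume "q \<in> ?P"
    then obtain x r where xr: "(x, r) \<in> Z" "q \<in> blk b x" by auto
    then have "?B q = {r * w..<Suc r * w}" using row cl div_eq_interval[OF assms(4), of r] by simp
    moreover have "Suc r * w \<le> ?N" using True xr(1) by (intro mult_le_mono1) auto
    ultimately show "?B q \<subseteq> {..<?N} \<and> card (?B q) = w" by auto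
  qed (use assms in auto)
  also have "card ?P = b * card Z"
  proof -
    have "card ?P = (\<Sum>x\<in>fst ` Z. card (blk b x))"
      using finZ blk_disjoint finite_blk by (intro card_UN_disjoint) auto
    then show ?thesis using assms(2) by (simp add: card_blk card_image)
  qed
  also have "real w / real ?N = 1 / real (2 * k)" using assms(4) by simp
  finally show ?thesis .
next
  case False
  then have "{f \<in> {1..n} \<rightarrow>\<^sub>E {..<2 * k * w}. \<forall>(x, r)\<in>Z. empty_cell k b w f r x} = {}"
    by (fastforce simp: empty_cell_def)
  then show ?thesis using assms(5) by (simp only: card.empty) (simp add: field_simps)
qed

section \<open>From greedy embeddings to the union bound\<close>

text \<open>Increasing columns put the chosen points in the order of the positions of
  \<open>\<pi>\<close>, increasing rows in the order of its values. The greedy side counts positions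
  and values from 0, hence the \<open>Suc\<close>.\<close>

lemma contains_pattern_of_greedy:
  assumes \<sigma>: "\<sigma> \<in> perms n" and \<pi>: "\<pi> \<in> perms k" and S: "S \<subseteq> {..<2 * k * w}" "card S = n"
    and t: "t < T" and bn: "b * (k + T) \<le> n"
    and p: "\<And>v. v < k \<Longrightarrow> p v < k \<and> \<pi> (Suc (p v)) = Suc v"
    and E: "E = empty_cell k b w (relabel n \<sigma> S)"
    and norun: "\<And>r x. x < k + T \<Longrightarrow> \<exists>j<R. \<not> E (r + j) x"
    and succ: "greedy E (\<lambda>v. p v + t) k \<le> 2 * k"
  shows "contains_pattern n \<sigma> k \<pi>"
proof -
  define F where "F = relabel n \<sigma> S"
  have finS: "finite S" using S(1) finite_subset by blast
  obtain s where s: "strict_mono_on {..<k} s" "\<And>v. v < k \<Longrightarrow> \<not> E (s v) (p v + t)"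
    "\<And>v. v < k \<Longrightarrow> s v < greedy E (\<lambda>v. p v + t) k"
  proof (rule greedy_strict_mono[of k R E "\<lambda>v. p v + t"])
    fix v r assume "v < k"
    then show "\<exists>j<R. \<not> E (r + j) (p v + t)" using p t by (intro norun add_strict_mono) auto
  qed blast
  \<comment> \<open>Success keeps all rows below \<open>2 * k\<close>, where a cell that is not
    empty really contains a point.\<close>
  have "\<exists>q. q \<in> blk b (p v + t) \<and> F q div w = s v" if "v < k" for v
    using s(2,3)[OF that] succ unfolding E F_def empty_cell_def by auto
  then obtain Q where Q: "\<And>v. v < k \<Longrightarrow> Q v \<in> blk b (p v + t)" "\<And>v. v < k \<Longrightarrow> F (Q v) div w = s v"
    by metis
  define x where "x i = Q (\<pi> i - 1)" for i
  have \<pi>r: "\<pi> i \<in> {1..k}" if "i \<in> {1..k}" for i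
    using perms_bij[OF \<pi>] that by (blast dest: bij_betwE)
  have \<pi>inj: "i = j" if "\<pi> i = \<pi> j" "i \<in> {1..k}" "j \<in> {1..k}" for i j
    using inj_onD[OF bij_betw_imp_inj_on[OF perms_bij[OF \<pi>]] that] .
  have pp: "p (\<pi> i - 1) = i - 1" if "i \<in> {1..k}" for i
  proof -
    have v: "\<pi> i - 1 < k" using \<pi>r[OF that] by auto
    have "\<pi> (Suc (p (\<pi> i - 1))) = \<pi> i" using p[OF v] \<pi>r[OF that] by simp
    then have "Suc (p (\<pi> i - 1)) = i" using \<pi>inj that p[OF v] by auto
    then show ?thesis by simp
  qed
  have xb: "x i \<in> blk b (i - 1 + t)" if "i \<in> {1..k}" for i
  proof -
    have "\<pi> i - 1 < k" using \<pi>r[OF that] by auto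
    from Q(1)[OF this] show ?thesis unfolding x_def pp[OF that] .
  qed
  have xn: "x i \<in> {1..n}" if "i \<in> {1..k}" for i
  proof -
    have "i - 1 + t < k + T" using that t by auto
    then show ?thesis using xb[OF that] blk_subset[OF _ bn] by blast
  qed
  have lt: "F (x i) < F (x j)" if "i \<in> {1..k}" "j \<in> {1..k}" "\<pi> i < \<pi> j" for i j
  proof -
    have v: "\<pi> i - 1 < k" "\<pi> j - 1 < k" "\<pi> i - 1 < \<pi> j - 1"
      using \<pi>r[OF that(1)] \<pi>r[OF that(2)] that(3) by auto
    have "s (\<pi> i - 1) < s (\<pi> j - 1)" using s(1) v by (auto simp: strict_mono_on_def)
    then have "F (x i) div w < F (x j) div w" unfolding x_def using Q(2) v by simp
    then show ?thesis by (meson div_le_mono leD leI)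
  qed
  have iff: "\<sigma> (x i) < \<sigma> (x j) \<longleftrightarrow> \<pi> i < \<pi> j" if "i \<in> {1..k}" "j \<in> {1..k}" for i j
  proof -
    have "\<sigma> (x i) < \<sigma> (x j) \<longleftrightarrow> F (x i) < F (x j)"
      using relabel_less_iff[OF \<sigma> finS S(2) xn xn] that unfolding F_def by simp
    moreover have "F (x i) < F (x j) \<longleftrightarrow> \<pi> i < \<pi> j"
      using lt[OF that] lt[OF that(2,1)] \<pi>inj[OF _ that] by (metis less_asym nat_neq_iff)
    ultimately show ?thesis by simp
  qed
  have "strict_mono_on {1..k} x"
  proof (rule strict_mono_onI)
    fix i j assume ij: "i \<in> {1..k}" "j \<in> {1..k}" "i < j"
    show "x i < x j" by (rule blk_less[OF _ xb xb]) (use ij in auto)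
  qed
  then show ?thesis unfolding contains_pattern_def using xn iff by blast
qed

text \<open>Union bound over runs of \<open>R\<close> empty cells and over witnesses with all cells
  empty. If neither occurs, \<open>many_failures_witness\<close> leaves every pattern a successful
  shift.\<close>

lemma prob_not_universal_le:
  assumes pos: "k > 0" "R > 0" "\<tau> > 0" "D > 0" and T: "T = 2 * R * \<tau>"
    and M: "M * (2 * R * T) < k + 2 * R * T" and bn: "b * (k + T) \<le> n" and Rk: "R \<le> 2 * k"
  shows "measure_pmf.prob (random_perm n) {\<sigma>. \<not> universal k n \<sigma>} \<le>
    2 * (real (k + T) * real (2 * k) * (1 - real R / real (2 * k)) ^ b +
         (real (R * k + 1) ^ (T * (k div D + 1)) *
          (real k * (real k * real (T * (R * D + 1)) ^ \<tau>)) ^ M) *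
         (1 - 1 / real (2 * k)) ^ (b * (M * \<tau>)))"
proof -
  \<comment> \<open>Rows this tall make \<open>N\<close> large enough for the birthday
    bound.\<close>
  define w where "w = n\<^sup>2 + 1"
  define N where "N = 2 * k * w"
  have wp: "w > 0" by (simp add: w_def)
  have N: "2 * n\<^sup>2 \<le> N" "0 < N"
  proof -
    have "2 * n\<^sup>2 \<le> 2 * 1 * w" by (simp add: w_def)
    also have "\<dots> \<le> N" unfolding N_def using pos by (intro mult_le_mono) auto
    finally show "2 * n\<^sup>2 \<le> N" .
  qed (use pos wp in \<open>simp add: N_def\<close>)
  let ?Fun = "{1..n} \<rightarrow>\<^sub>E {..<N}"
  let ?E = "empty_cell k b w"
  let ?W = "witnesses k T R D \<tau> M"
  define F1 where "F1 x r = {f\<in>?Fun. \<forall>j<R. ?E f (r + j) x}" for x r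
  define F2 where "F2 Z = {f\<in>?Fun. \<forall>(x, r)\<in>Z. ?E f r x}" for Z
  define I where "I = {..<k + T} \<times> {r. r + R \<le> 2 * k}"
  define F where "F = (\<Union>(x, r)\<in>I. F1 x r) \<union> (\<Union>Z\<in>?W. F2 Z)"
  have finFun: "finite ?Fun" by (intro finite_PiE) auto
  have "finite F" by (rule finite_subset[OF _ finFun]) (auto simp: F_def F1_def F2_def)
  have sub: "relabel n \<sigma> S \<in> F"
    if \<sigma>: "\<sigma> \<in> perms n" "\<sigma> \<in> {\<sigma>. \<not> universal k n \<sigma>}"
      and S: "S \<subseteq> {..<N}" "card S = n" for \<sigma> S
  proof (rule ccontr)
    assume nF: "relabel n \<sigma> S \<notin> F"
    have finS: "finite S" using S(1) finite_subset by blast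
    have Fun: "relabel n \<sigma> S \<in> ?Fun"
      using relabel_image[OF \<sigma>(1) finS S(2)] S(1) by (auto simp: relabel_def)
    define E where "E = ?E (relabel n \<sigma> S)"
    have norun: "\<exists>j<R. \<not> E (r + j) x" if "x < k + T" for r x
    proof (rule ccontr)
      assume a: "\<not> ?thesis"
      \<comment> \<open>The top cell of the run is empty, hence below row \<open>2 * k\<close>, so
        the whole run fits into the grid.\<close>
      then have "E (r + (R - 1)) x" using pos(2) by (metis diff_less less_numeral_extra(1))
      then have "r + R \<le> 2 * k" using pos by (auto simp: E_def empty_cell_def)
      then have "(x, r) \<in> I" using that by (simp add: I_def)
      moreover have "relabel n \<sigma> S \<in> F1 x r" using a Fun by (auto simp: F1_def E_def)
      ultimately show False using nF by (auto simp: F_def)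
    qed
    obtain \<pi> where \<pi>: "\<pi> \<in> perms k" "\<not> contains_pattern n \<sigma> k \<pi>"
      using \<sigma>(2) by (auto simp: universal_def)
    define p where "p v = inv \<pi> (Suc v) - 1" for v
    have pm: "\<pi> permutes {1..k}" using \<pi>(1) by (simp add: perms_def)
    have p: "p v < k \<and> \<pi> (Suc (p v)) = Suc v" if "v < k" for v
    proof -
      have "inv \<pi> (Suc v) \<in> {1..k}"
        using permutes_in_image[OF permutes_inv[OF pm], of "Suc v"] that by simp
      then have "Suc (p v) = inv \<pi> (Suc v)" "p v < k" by (auto simp: p_def)
      then show ?thesis using permutes_inverses(1)[OF pm] by simp
    qed
    have p1: "inj_on p {..<k}" using p by (metis inj_onI lessThan_iff nat.inject)
    have p2: "p ` {..<k} \<subseteq> {..<k}" using p by auto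
    have gr: "2 * k < greedy E (\<lambda>v. p v + t) k" if "t < T" for t
      using contains_pattern_of_greedy[OF \<sigma>(1) \<pi>(1) _ S(2) that bn p E_def norun]
        S(1) \<pi>(2) unfolding N_def by (meson not_le)
    from many_failures_witness[OF norun p1 p2 pos T M gr]
    obtain Z where "Z \<in> ?W" "\<forall>(x, r)\<in>Z. E r x" by blast
    then have "relabel n \<sigma> S \<in> F2 Z" using Fun by (auto simp: F2_def E_def)
    then show False using nF \<open>Z \<in> ?W\<close> by (auto simp: F_def)
  qed
  have finI: "finite I"
    unfolding I_def by (rule finite_cartesian_product) (auto intro: finite_subset[of _ "{..2 * k}"])
  define \<alpha> where "\<alpha> = (1 - real R / real (2 * k)) ^ b"
  define \<beta> where "\<beta> = (1 - 1 / real (2 * k)) ^ (b * (M * \<tau>))"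
  define K where "K = real (R * k + 1) ^ (T * (k div D + 1)) *
    (real k * (real k * real (T * (R * D + 1)) ^ \<tau>)) ^ M"
  have nonneg: "0 \<le> \<alpha>" "0 \<le> \<beta>"
    unfolding \<alpha>_def \<beta>_def using Rk pos(1) by (auto intro!: zero_le_power)
  have "card (\<Union>(x, r)\<in>I. F1 x r) \<le> (\<Sum>(x, r)\<in>I. card (F1 x r))"
    using card_UN_le[OF finI, of "\<lambda>(x, r). F1 x r"] by (simp add: case_prod_unfold)
  then have "real (card (\<Union>(x, r)\<in>I. F1 x r)) \<le> (\<Sum>(x, r)\<in>I. real (card (F1 x r)))"
    by (simp add: case_prod_unfold flip: of_nat_sum)
  also have "\<dots> = (\<Sum>(x, r)\<in>I. real N ^ n * \<alpha>)"
  proof (intro sum.cong refl, clarify)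
    fix x r assume "(x, r) \<in> I"
    then have "x < k + T" "r + R \<le> 2 * k" by (auto simp: I_def)
    then show "real (card (F1 x r)) = real N ^ n * \<alpha>"
      unfolding F1_def N_def \<alpha>_def using card_empty_run[OF _ bn wp pos(1)] by blast
  qed
  also have "\<dots> = real (card I) * (real N ^ n * \<alpha>)" by (simp add: case_prod_unfold)
  also have "\<dots> \<le> (real (k + T) * real (2 * k)) * (real N ^ n * \<alpha>)"
  proof (rule mult_right_mono)
    have "card I \<le> card ({..<k + T} \<times> {..<2 * k})"
      unfolding I_def using pos by (intro card_mono) auto
    also have "\<dots> = (k + T) * (2 * k)" by (simp add: card_cartesian_product)
    finally show "real (card I) \<le> real (k + T) * real (2 * k)"
      by (metis of_nat_le_iff of_nat_mult)
  qed (use nonneg in simp)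
  finally have runs: "real (card (\<Union>(x, r)\<in>I. F1 x r)) \<le>
      real N ^ n * (real (k + T) * real (2 * k) * \<alpha>)" by (simp only: mult_ac)
  have "real (card (\<Union>Z\<in>?W. F2 Z)) \<le> (\<Sum>Z\<in>?W. real (card (F2 Z)))"
    using card_UN_le[OF card_witnesses(1)] by (simp flip: of_nat_sum)
  also have "\<dots> \<le> (\<Sum>Z\<in>?W. real N ^ n * \<beta>)"
  proof (rule sum_mono)
    fix Z assume "Z \<in> ?W"
    then have Z: "fst ` Z \<subseteq> {..<k + T}" "inj_on fst Z" "card Z = M * \<tau>"
      by (auto simp: witnesses_def)
    show "real (card (F2 Z)) \<le> real N ^ n * \<beta>"
      using card_empty_cells[OF Z(1,2) bn wp pos(1)] unfolding F2_def N_def \<beta>_def Z(3) .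
  qed
  also have "\<dots> = real (card ?W) * (real N ^ n * \<beta>)" by simp
  also have "\<dots> \<le> K * (real N ^ n * \<beta>)"
  proof (rule mult_right_mono)
    have "real (card ?W) \<le>
      real ((R * k + 1) ^ (T * (k div D + 1)) * (k * (k * (T * (R * D + 1)) ^ \<tau>)) ^ M)"
      by (rule of_nat_mono[OF card_witnesses(2)])
    then show "real (card ?W) \<le> K" by (simp only: K_def of_nat_mult of_nat_power)
  qed (use nonneg in simp)
  finally have wits: "real (card (\<Union>Z\<in>?W. F2 Z)) \<le> real N ^ n * (K * \<beta>)" by (simp only: mult_ac)
  have "card F \<le> card (\<Union>(x, r)\<in>I. F1 x r) + card (\<Union>Z\<in>?W. F2 Z)"
    unfolding F_def by (rule card_Un_le)
  then have "real (card F) \<le> real N ^ n * (real (k + T) * real (2 * k) * \<alpha> + K * \<beta>)"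
    using runs wits unfolding distrib_left by linarith
  then have le: "real (card F) / real N ^ n \<le> real (k + T) * real (2 * k) * \<alpha> + K * \<beta>"
    using N(2) by (simp add: pos_divide_le_eq mult.commute)
  have "measure_pmf.prob (random_perm n) {\<sigma>. \<not> universal k n \<sigma>} \<le>
      2 * (real (card F) / real N ^ n)"
    by (rule prob_random_perm_le[OF N \<open>finite F\<close>]) (rule sub)
  also have "\<dots> \<le> 2 * (real (k + T) * real (2 * k) * \<alpha> + K * \<beta>)"
    by (rule mult_left_mono[OF le]) simp
  finally show ?thesis unfolding \<alpha>_def \<beta>_def K_def .
qed

subsection \<open>Choice of parameters\<close>

lemma one_minus_power_le_exp:
  fixes y :: real
  assumes "0 \<le> y" "y \<le> 1" "c \<le> y * real b"
  shows "(1 - y) ^ b \<le> exp (- c)"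
proof -
  have "(1 - y) ^ b \<le> exp (- y) ^ b"
    using assms exp_ge_add_one_self[of "- y"] by (intro power_mono) auto
  also have "\<dots> = exp (- (y * real b))" by (simp add: exp_of_nat_mult[symmetric] mult.commute)
  also have "\<dots> \<le> exp (- c)" using assms(3) by simp
  finally show ?thesis .
qed

text \<open>With \<open>R = \<tau> = l\<close>, columns have width at least
  \<open>200 * k * ln l\<close>, so a cell is empty with probability at most \<open>l\<close> to the
  power -100. This beats the cost of describing witnesses, about 13 factors \<open>l\<close> per
  cell.\<close>

lemma prob_not_universal_le_inverse:
  fixes k n l :: nat
  assumes l: "ln (real k) \<le> real l" "real l \<le> ln (real k) + 1"
    and k: "3 \<le> ln (real k)" "l ^ 5 \<le> k"
    and n: "\<bar>real n - 2000 * (real k)\<^sup>2 * ln (ln (real k))\<bar> < 1"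
  shows "measure_pmf.prob (random_perm n) {\<sigma>. \<not> universal k n \<sigma>} \<le> 10 / real k"
proof -
  define x where "x = real l"
  define y where "y = ln x"
  define T where "T = 2 * l * l"
  \<comment> \<open>Storing about \<open>T * k / D\<close> rows at \<open>2 * l\<close> in the
    exponent each costs \<open>4 * k / l ^ 3\<close>, less than the gain of order
    \<open>k / l ^ 2\<close> by the empty cells.\<close>
  define D where "D = l ^ 6"
  \<comment> \<open>The quotient \<open>k / (2 * l * T)\<close> rounded up.\<close>
  define M where "M = (k + 2 * l * T - 1) div (2 * l * T)"
  define b where "b = n div (k + T)"
  have x3: "3 \<le> x" and l3: "3 \<le> l" using k(1) l(1) by (auto simp: x_def)
  have kp: "k > 0" using k(1) by (cases "k = 0") auto
  have y1: "1 \<le> y"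
  proof -
    have "exp 1 \<le> x" using exp_le x3 by linarith
    then show ?thesis unfolding y_def using x3 by (simp add: ln_ge_iff)
  qed
  have kx: "real k \<le> exp x" using l(1) kp by (metis exp_le_cancel_iff exp_ln of_nat_0_less_iff x_def)
  have k5: "l ^ 5 \<le> k" by (rule k(2))
  have Tk: "T \<le> k" and lk: "l + 1 \<le> k"
  proof -
    have "2 * l\<^sup>2 \<le> l ^ 3 * l\<^sup>2"
      by (intro mult_le_mono1 order_trans[OF _ power_mono[OF l3, of 3]]) simp_all
    also have "\<dots> = l ^ 5" by (simp flip: power_add)
    finally show "T \<le> k" using k5 by (simp add: T_def power2_eq_square)
    have "l + 1 \<le> 2 * l\<^sup>2" using l3 le_square[of l] unfolding power2_eq_square by linarith
    then show "l + 1 \<le> k" using \<open>T \<le> k\<close> by (simp add: T_def power2_eq_square)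
  qed
  have b: "100 * y * (2 * real k) \<le> real b"
  proof -
    define L where "L = ln (ln (real k))"
    have L1: "1 \<le> L"
    proof -
      have "exp 1 \<le> ln (real k)" using exp_le k(1) by linarith
      then show ?thesis unfolding L_def using k(1) by (simp add: ln_ge_iff)
    qed
    \<comment> \<open>Crude, but after taking logarithms it only costs a factor 2.\<close>
    have "x \<le> (ln (real k))\<^sup>2"
    proof -
      have "3 * ln (real k) \<le> ln (real k) * ln (real k)" using k(1) by (intro mult_right_mono) auto
      then show ?thesis using l(2) k(1) unfolding x_def power2_eq_square by linarith
    qed
    then have "y \<le> ln ((ln (real k))\<^sup>2)" unfolding y_def using x3 by (intro ln_mono) auto
    then have yL: "y \<le> 2 * L" using k(1) by (simp add: L_def ln_realpow)
    have k2: "1 \<le> real k" using kp by simp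
    have "100 * y * (2 * real k) \<le> 400 * L * real k"
      using mult_right_mono[OF yL, of "real k"] by simp
    also have "\<dots> \<le> 1000 * real k * L - 2"
    proof -
      have "1 * 1 \<le> real k * L" using k2 L1 by (intro mult_mono) auto
      then show ?thesis by (simp add: mult.commute mult.left_commute)
    qed
    also have "\<dots> \<le> real n / (2 * real k) - 1"
    proof -
      have "2000 * (real k)\<^sup>2 * L - 1 \<le> real n" using n unfolding L_def by linarith
      then have "(2000 * (real k)\<^sup>2 * L - 1) / (2 * real k) \<le> real n / (2 * real k)"
        by (rule divide_right_mono) simp
      moreover have "(2000 * (real k)\<^sup>2 * L - 1) / (2 * real k) = 1000 * real k * L - 1 / (2 * real k)"
        using kp by (simp add: field_simps power2_eq_square)
      moreover have "1 / (2 * real k) \<le> 1" using kp by simp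
      ultimately show ?thesis by linarith
    qed
    also have "\<dots> \<le> real n / real (k + T) - 1"
      using Tk kp by (intro diff_right_mono divide_left_mono) auto
    also have "\<dots> \<le> real b"
    proof -
      have "n < k + T + b * (k + T)"
        unfolding b_def using kp by (intro dividend_less_div_times) simp
      then have "real n < real (k + T + b * (k + T))" by (simp only: of_nat_less_iff)
      then have "real n < (real b + 1) * real (k + T)" by (simp add: algebra_simps)
      then have "real n / real (k + T) < real b + 1" using kp by (simp add: pos_divide_less_eq)
      then show ?thesis by linarith
    qed
    finally show ?thesis .
  qed
  have e1: "(1 - real l / real (2 * k)) ^ b \<le> exp (- (100 * x))"
  proof (rule one_minus_power_le_exp)
    show "real l / real (2 * k) \<le> 1" using lk kp by simp
    have "100 * x = x * (100 * 1)" by simp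
    also have "\<dots> \<le> x * (100 * y)" using x3 y1 by (intro mult_left_mono) auto
    also have "\<dots> = x / (2 * real k) * (100 * y * (2 * real k))" using kp by simp
    also have "\<dots> \<le> x / (2 * real k) * real b" using x3 by (intro mult_left_mono b) auto
    finally show "100 * x \<le> real l / real (2 * k) * real b" by (simp add: x_def)
  qed simp
  have e2: "(1 - 1 / real (2 * k)) ^ (b * (M * l)) \<le> exp (- (100 * y * real (M * l)))"
  proof (rule one_minus_power_le_exp)
    have "100 * y * real (M * l) = 1 / (2 * real k) * (100 * y * (2 * real k)) * real (M * l)"
      using kp by simp
    also have "\<dots> \<le> 1 / (2 * real k) * real b * real (M * l)"
      by (intro mult_right_mono mult_left_mono b) auto
    finally show "100 * y * real (M * l) \<le> 1 / real (2 * k) * real (b * (M * l))"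
      by (simp add: mult.assoc)
  qed (use kp in auto)
  have kk: "real k * real k \<le> exp (2 * x)"
    using mult_mono[OF kx kx] by (simp flip: exp_add)
  have xy: "x ^ m = exp (real m * y)" for m
    using x3 by (simp add: y_def exp_of_nat_mult)
  have K1: "real (l * k + 1) ^ (T * (k div D + 1)) \<le> exp (4 * real k / x ^ 3 + 4 * x ^ 3)"
  proof -
    have "l * k + 1 \<le> (l + 1) * k" using kp by simp
    also have "\<dots> \<le> k * k" using lk by (rule mult_le_mono1)
    finally have "real (l * k + 1) \<le> real k * real k" by (metis of_nat_le_iff of_nat_mult)
    then have "real (l * k + 1) \<le> exp (2 * x)" using kk by linarith
    then have "real (l * k + 1) ^ (T * (k div D + 1)) \<le> exp (2 * x) ^ (T * (k div D + 1))"
      by (intro power_mono) auto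
    also have "\<dots> = exp (real (T * (k div D + 1)) * (2 * x))" by (simp only: exp_of_nat_mult)
    also have "\<dots> \<le> exp (4 * real k / x ^ 3 + 4 * x ^ 3)"
    proof -
      have "real (k div D) \<le> real k / x ^ 6"
        using of_nat_div_le_of_nat[of k D, where ?'a = real] by (simp add: D_def x_def)
      then have "2 * x * x * (real (k div D) + 1) * (2 * x) \<le> 2 * x * x * (real k / x ^ 6 + 1) * (2 * x)"
        using x3 by (intro mult_right_mono mult_left_mono) auto
      also have "\<dots> = 4 * real k / x ^ 3 + 4 * x ^ 3"
        using x3 by (simp add: field_simps power_numeral_reduce)
      also have "2 * x * x * (real (k div D) + 1) * (2 * x) = real (T * (k div D + 1)) * (2 * x)"
        by (simp only: T_def x_def of_nat_mult of_nat_add of_nat_numeral of_nat_1)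
      finally show ?thesis by simp
    qed
    finally show ?thesis .
  qed
  \<comment> \<open>The 13 arises as 11 + 2:
    \<open>T * (l * D + 1) \<le> 4 * x ^ 9 \<le> x ^ 11\<close> for each cell, and
    \<open>k * k \<le> exp (2 * x)\<close> is spread over the \<open>l\<close> cells of a star using
    \<open>1 \<le> y\<close>.\<close>
  have K2: "(real k * (real k * real (T * (l * D + 1)) ^ l)) ^ M \<le> exp (13 * y * real (M * l))"
  proof -
    have "real (T * (l * D + 1)) = 2 * x\<^sup>2 * (x ^ 7 + 1)"
      by (simp add: T_def D_def x_def power2_eq_square power_numeral_reduce algebra_simps)
    also have "\<dots> \<le> 2 * x\<^sup>2 * (x ^ 7 + x ^ 7)"
      using x3 one_le_power[of x 7] by (intro mult_left_mono add_left_mono) auto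
    also have "\<dots> = 4 * x ^ 9" by (simp add: power_numeral_reduce)
    also have "\<dots> \<le> x\<^sup>2 * x ^ 9"
      using x3 power_mono[of 3 x 2] by (intro mult_right_mono) auto
    also have "\<dots> = exp (11 * y)" using xy[of 11] by (simp flip: power_add)
    finally have "real (T * (l * D + 1)) ^ l \<le> exp (11 * y) ^ l" by (intro power_mono) auto
    also have "\<dots> = exp (11 * y * x)" by (simp add: x_def exp_of_nat_mult[symmetric] mult.commute)
    finally have "real k * real k * real (T * (l * D + 1)) ^ l \<le> exp (2 * x) * exp (11 * y * x)"
      by (intro mult_mono kk) auto
    also have "\<dots> = exp (2 * x + 11 * y * x)" by (simp add: exp_add)
    also have "\<dots> \<le> exp (13 * y * x)"
      using mult_right_mono[OF y1, of x] x3 by simp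
    finally have "(real k * (real k * real (T * (l * D + 1)) ^ l)) ^ M \<le> exp (13 * y * x) ^ M"
      by (intro power_mono) (auto simp: mult.assoc)
    also have "\<dots> = exp (13 * y * real (M * l))"
      by (simp add: x_def exp_of_nat_mult[symmetric] mult_ac)
    finally show ?thesis .
  qed
  have Ml: "real k / (4 * x\<^sup>2) \<le> real (M * l)"
  proof -
    define d where "d = 2 * l * T"
    have "0 < d" using l3 by (simp add: T_def d_def)
    then have "k \<le> (k + d - 1) div d * d"
      using div_mult_mod_eq[of "k + d - 1" d] mod_less_divisor[of d "k + d - 1"] by linarith
    then have "k \<le> M * (2 * l * T)" by (simp only: M_def d_def)
    then have "real k \<le> real (M * (2 * l * T))" by (simp only: of_nat_le_iff)
    also have "\<dots> = real (M * l) * (4 * x\<^sup>2)" by (simp add: T_def x_def power2_eq_square)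
    finally show ?thesis using x3 by (simp add: pos_divide_le_eq)
  qed
  have t1: "real (k + T) * real (2 * k) * (1 - real l / real (2 * k)) ^ b \<le> 4 * exp (- x)"
  proof -
    have "real (k + T) * real (2 * k) \<le> (2 * real k) * (2 * real k)"
      using Tk by (intro mult_mono) auto
    also have "\<dots> \<le> 4 * exp (2 * x)" using kk by simp
    finally have "real (k + T) * real (2 * k) * (1 - real l / real (2 * k)) ^ b \<le>
        4 * exp (2 * x) * exp (- (100 * x))"
      by (rule mult_mono[OF _ e1]) (use lk kp in \<open>auto intro!: zero_le_power\<close>)
    also have "\<dots> = 4 * exp (- (98 * x))" by (simp flip: exp_add)
    also have "\<dots> \<le> 4 * exp (- x)" using x3 by simp
    finally show ?thesis .
  qed
  have t2: "real (l * k + 1) ^ (T * (k div D + 1)) *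
      (real k * (real k * real (T * (l * D + 1)) ^ l)) ^ M *
      (1 - 1 / real (2 * k)) ^ (b * (M * l)) \<le> exp (- x)"
  proof -
    have "real (l * k + 1) ^ (T * (k div D + 1)) *
      (real k * (real k * real (T * (l * D + 1)) ^ l)) ^ M *
      (1 - 1 / real (2 * k)) ^ (b * (M * l)) \<le>
      exp (4 * real k / x ^ 3 + 4 * x ^ 3) * exp (13 * y * real (M * l)) *
      exp (- (100 * y * real (M * l)))"
      using kp by (intro mult_mono K1 K2 e2) (auto intro!: zero_le_power mult_nonneg_nonneg)
    also have "\<dots> = exp (4 * real k / x ^ 3 + 4 * x ^ 3 - 87 * (y * real (M * l)))"
      by (simp flip: exp_add)
    also have "\<dots> \<le> exp (- x)"
    proof -
      \<comment> \<open>Everything is compared with \<open>z\<close>: the positive terms are at most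
        \<open>8 * z\<close>, the negative one is at least \<open>87 * z / 4\<close> in size, and
        \<open>x \<le> z\<close>.\<close>
      define z where "z = real k / x\<^sup>2"
      have "4 * z / x \<le> 4 * z / 1"
        using x3 by (intro divide_left_mono) (auto simp: z_def)
      then have z1: "4 * real k / x ^ 3 \<le> 4 * z" by (simp add: z_def power_numeral_reduce)
      have "x ^ 5 \<le> real k" using k5 unfolding x_def by (metis of_nat_le_iff of_nat_power)
      then have "x ^ 5 / x\<^sup>2 \<le> z" unfolding z_def by (rule divide_right_mono) simp
      moreover have "x ^ 5 / x\<^sup>2 = x ^ 3" using x3 by (simp add: power_numeral_reduce)
      ultimately have z2: "x ^ 3 \<le> z" by simp
      have z3: "x \<le> x ^ 3" using x3 by (intro self_le_power) auto
      have "z / 4 \<le> real (M * l)" using Ml by (simp add: z_def)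
      also have "\<dots> \<le> y * real (M * l)" using mult_right_mono[OF y1, of "real (M * l)"] by simp
      finally show ?thesis using z1 z2 z3 x3 by simp
    qed
    finally show ?thesis .
  qed
  have "measure_pmf.prob (random_perm n) {\<sigma>. \<not> universal k n \<sigma>} \<le>
    2 * (real (k + T) * real (2 * k) * (1 - real l / real (2 * k)) ^ b +
         (real (l * k + 1) ^ (T * (k div D + 1)) *
          (real k * (real k * real (T * (l * D + 1)) ^ l)) ^ M) *
         (1 - 1 / real (2 * k)) ^ (b * (M * l)))"
  proof (rule prob_not_universal_le)
    have "M * (2 * l * T) \<le> k + 2 * l * T - 1" unfolding M_def by (rule div_times_less_eq_dividend)
    then show "M * (2 * l * T) < k + 2 * l * T" using kp by linarith
    show "b * (k + T) \<le> n" unfolding b_def by (rule div_times_less_eq_dividend)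
  qed (use kp l3 lk in \<open>auto simp: D_def T_def\<close>)
  also have "\<dots> \<le> 2 * (4 * exp (- x) + exp (- x))"
    using t1 t2 by (intro mult_left_mono add_mono) (auto simp: mult.assoc)
  also have "\<dots> = 10 / exp x" by (simp add: exp_minus field_simps)
  also have "\<dots> \<le> 10 / real k" using kx kp by (intro divide_left_mono) auto
  finally show ?thesis .
qed

theorem theorem1p2:
  fixes n :: "nat \<Rightarrow> nat"
  assumes "\<forall>\<^sub>F k in sequentially. \<bar>real (n k) - 2000 * (real k)\<^sup>2 * ln (ln (real k))\<bar> < 1"
  shows "(\<lambda>k. measure_pmf.prob (random_perm (n k)) {\<sigma>. universal k (n k) \<sigma>}) \<longlonglongrightarrow> 1"
proof (rule tendsto_sandwich)
  have "\<forall>\<^sub>F k in sequentially. 3 \<le> ln (real k)" by real_asymp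
  \<comment> \<open>The added 1 leaves room for rounding \<open>ln k\<close> up to the integer
    \<open>l\<close>.\<close>
  moreover have "\<forall>\<^sub>F k in sequentially. (ln (real k) + 1) ^ 5 \<le> real k" by real_asymp
  ultimately show "\<forall>\<^sub>F k in sequentially. 1 - 10 / real k \<le>
      measure_pmf.prob (random_perm (n k)) {\<sigma>. universal k (n k) \<sigma>}"
    using assms
  proof eventually_elim
    case (elim k)
    define l where "l = nat \<lceil>ln (real k)\<rceil>"
    have l: "ln (real k) \<le> real l" "real l \<le> ln (real k) + 1"
      unfolding l_def using elim(1) by linarith+
    have "real l ^ 5 \<le> (ln (real k) + 1) ^ 5" by (rule power_mono[OF l(2)]) simp
    also have "\<dots> \<le> real k" by (rule elim(2))
    finally have "l ^ 5 \<le> k" by (simp flip: of_nat_power)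
    from prob_not_universal_le_inverse[OF l elim(1) this elim(3)]
    show ?case
      using measure_pmf.prob_compl[of "{\<sigma>. universal k (n k) \<sigma>}" "random_perm (n k)"]
      by (simp add: set_diff_eq)
  qed
  show "(\<lambda>k. 1 - 10 / real k) \<longlonglongrightarrow> 1" by real_asymp
qed auto

end
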